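(* For each $n \in \mathbb{N}$, the spectral radius $\rho(A_n)$ of the matrix $A_n$ is bounded above by $2$.
   Context: For $n \in \mathbb{N} = \{1,2,3,\ldots\}$, $A_n$ denotes the $n \times n$ real symmetric tridiagonal matrix whose diagonal entries are all $0$, whose superdiagonal and subdiagonal entries are all $1$, and whose other entries are all $0$ (so $A_1 = [0]$). For a square complex matrix $A$, the spectral radius is $\rho(A) = \max\{|\lambda| : \lambda \text{ is an eigenvalue of } A\}$. *)

theory Defs
  imports "Jordan_Normal_Form.Spectral_Radius"
begin

definition tridiag_A :: "nat \<Rightarrow> real mat" where
  "tridiag_A n = mat n n (\<lambda>(i, j). if j = i + 1 \<or> i = j + 1 then 1 else 0)"

end

(* Gershgorin-type bound: at a coordinate where an eigenvector is maximal in modulus, the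
   eigenvalue equation bounds the eigenvalue by the absolute row sum, which here is at most 2. *)
theory Submission
  imports Defs
begin

text \<open>Let \<open>v\<close> be an eigenvector for \<open>k\<close> and \<open>i\<close> an
  index where |v_i| is largest. Row \<open>i\<close> of the eigenvalue equation gives |k| |v_i|
  \<le> (sum over j of |A_ij|) |v_i|, and |v_i| > 0 cancels. So a common bound on the absolute row
  sums bounds every eigenvalue, hence the spectral radius; for \<open>tridiag_A\<close> the bound 2
  comes from \<open>tridiag_A_row_sum\<close>.\<close>

lemma eigenvalue_norm_le_row_sum:
  fixes A :: "complex mat"
  assumes A: "A \<in> carrier_mat n n"
    and ev: "eigenvalue A k"
    and row: "\<And>i. i < n \<Longrightarrow> (\<Sum>j<n. norm (A $$ (i, j))) \<le> c"
  shows "norm k \<le> c"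
proof -
  obtain v where v: "v \<in> carrier_vec n" "v \<noteq> 0\<^sub>v n" "A *\<^sub>v v = k \<cdot>\<^sub>v v"
    using ev A unfolding eigenvalue_def eigenvector_def by auto
  obtain m where m: "m < n" "v $ m \<noteq> 0"
    using v(1,2) by (metis carrier_vecD eq_vecI index_zero_vec(1,2))
  define M where "M = Max ((\<lambda>i. norm (v $ i)) ` {..<n})"
  have le_M: "norm (v $ j) \<le> M" if "j < n" for j
    unfolding M_def using that by (intro Max_ge) auto
  have "M \<in> (\<lambda>i. norm (v $ i)) ` {..<n}"
    unfolding M_def using m(1) by (intro Max_in) auto
  then obtain i where i: "i < n" "norm (v $ i) = M" by auto
  \<comment> \<open>The nonzero entry at \<open>m\<close> makes the maximum positive, so that it can
    be cancelled at the end.\<close>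
  have "M > 0" using le_M[OF m(1)] m(2) by (smt (verit) zero_less_norm_iff)
  have "k * v $ i = (A *\<^sub>v v) $ i" using v i by simp
  also have "\<dots> = (\<Sum>j<n. A $$ (i, j) * v $ j)"
    using A v(1) i(1) by (simp add: scalar_prod_def lessThan_atLeast0)
  finally have "norm k * M = norm (\<Sum>j<n. A $$ (i, j) * v $ j)"
    by (metis i(2) norm_mult)
  also have "\<dots> \<le> (\<Sum>j<n. norm (A $$ (i, j)) * M)"
    by (rule sum_norm_le) (auto simp: norm_mult intro!: mult_left_mono le_M)
  also have "\<dots> = (\<Sum>j<n. norm (A $$ (i, j))) * M" by (simp add: sum_distrib_right)
  also have "\<dots> \<le> c * M" using row[OF i(1)] \<open>M > 0\<close> by simp
  finally show ?thesis using \<open>M > 0\<close> by simp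
qed

text \<open>The entries are 0 or 1, so the sum counts the neighbours of \<open>i\<close> on the path
  0, ..., n - 1.\<close>

lemma tridiag_A_row_sum:
  assumes "i < n"
  shows "(\<Sum>j<n. norm (map_mat complex_of_real (tridiag_A n) $$ (i, j))) \<le> 2"
proof -
  have "(\<Sum>j<n. norm (map_mat complex_of_real (tridiag_A n) $$ (i, j)))
      = (\<Sum>j<n. if j \<in> {j. j = i + 1 \<or> i = j + 1} then 1 else 0)"
    using assms by (intro sum.cong) (auto simp: tridiag_A_def)
  also have "\<dots> = card ({..<n} \<inter> {j. j = i + 1 \<or> i = j + 1})"
    by (simp only: sum.inter_restrict[symmetric] finite_lessThan) simp
  \<comment> \<open>For \<open>i = 0\<close> truncated subtraction makes \<open>i - 1\<close> equal
    to 0; this only enlarges the set.\<close>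
  also have "\<dots> \<le> card {i + 1, i - 1}"
    by (intro of_nat_mono card_mono) auto
  also have "\<dots> \<le> 2" by (simp add: card_insert_if)
  finally show ?thesis by simp
qed

theorem theorem4p4:
  fixes n :: nat
  assumes "n \<ge> 1"
  shows "spectral_radius (map_mat complex_of_real (tridiag_A n)) \<le> 2"
proof -
  let ?A = "map_mat complex_of_real (tridiag_A n)"
  have A: "?A \<in> carrier_mat n n" by (simp add: tridiag_A_def)
  \<comment> \<open>Since \<open>n\<close> is positive the spectrum is nonempty, and the maximum is
    attained.\<close>
  obtain k where "eigenvalue ?A k" "spectral_radius ?A = norm k"
    using spectral_radius_mem_max(1)[OF A] assms by (auto simp: spectrum_def)
  then show ?thesis
    using eigenvalue_norm_le_row_sum[OF A _ tridiag_A_row_sum] by simp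
qed

end
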